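(* Let $C_3$ be the directed cycle on 3 vertices. The problem $\Pi'_{C_3}$ (given an oriented graph $G$, does $G$ contain an induced subdivision of $C_3$?) is polynomial-time solvable.
   Context: All digraphs are finite and simple (no loops, no parallel arcs). An oriented graph is a digraph with no directed 2-cycle. A subdivision of a digraph $D$ is a digraph obtained from $D$ by replacing each arc $ab$ by a directed $(a,b)$-path of length at least 1, these paths being internally disjoint with new internal vertices. An induced subdivision of $D$ in $G$ is an induced subdigraph of $G$ that is (isomorphic to) a subdivision of $D$. For a fixed digraph $D$, $\Pi'_D$ is the decision problem: Input: an oriented graph $G$. Question: does $G$ contain an induced subdivision of $D$? *)

theory Defs
  imports "Graph_Theory.Digraph_Component" "HOL-Computational_Algebra.Polynomial"
begin

section \<open>Oriented graphs and induced subdivisions\<close>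

definition oriented_graph :: "'a pair_pre_digraph \<Rightarrow> bool" where
  "oriented_graph G \<longleftrightarrow>
     pair_digraph G \<and> (\<forall>u v. (u, v) \<in> parcs G \<longrightarrow> (v, u) \<notin> parcs G)"

text \<open>The internal vertices of a path, given by its list of arcs, are the heads of all arcs
  but the last.\<close>

definition internal_verts :: "('a \<times> 'a) awalk \<Rightarrow> 'a set" where
  "internal_verts p = snd ` set (butlast p)"

text \<open>\<open>H\<close> is isomorphic to a subdivision of \<open>D\<close>: the map \<open>f\<close> embeds the vertices of \<open>D\<close> and
  \<open>P e\<close> is the path of \<open>H\<close> that replaces the arc \<open>e\<close>. The last two conditions say that \<open>H\<close>
  consists of nothing but these branch vertices and paths.\<close>

definition is_subdivision :: "'a pair_pre_digraph \<Rightarrow> 'b pair_pre_digraph \<Rightarrow> bool" where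
  "is_subdivision D H \<longleftrightarrow>
     (\<exists>(f :: 'a \<Rightarrow> 'b) (P :: 'a \<times> 'a \<Rightarrow> ('b \<times> 'b) awalk).
        inj_on f (pverts D) \<and>
        (\<forall>(a, b) \<in> parcs D.
           pre_digraph.apath (with_proj H) (f a) (P (a, b)) (f b) \<and> length (P (a, b)) \<ge> 1) \<and>
        (\<forall>e \<in> parcs D. internal_verts (P e) \<inter> f ` pverts D = {}) \<and>
        (\<forall>e \<in> parcs D. \<forall>e' \<in> parcs D.
           e \<noteq> e' \<longrightarrow> internal_verts (P e) \<inter> internal_verts (P e') = {}) \<and>
        pverts H = f ` pverts D \<union> (\<Union>e \<in> parcs D. internal_verts (P e)) \<and>
        parcs H = (\<Union>e \<in> parcs D. set (P e)))"

definition has_induced_subdivision :: "'a pair_pre_digraph \<Rightarrow> 'b pair_pre_digraph \<Rightarrow> bool" where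
  "has_induced_subdivision D G \<longleftrightarrow>
     (\<exists>H :: 'b pair_pre_digraph.
        induced_subgraph (with_proj H) (with_proj G) \<and> is_subdivision D H)"

definition C3 :: "nat pair_pre_digraph" where
  "C3 = \<lparr> pverts = {0, 1, 2}, parcs = {(0, 1), (1, 2), (2, 0)} \<rparr>"


section \<open>Deterministic multitape Turing machines\<close>

datatype move = MoveLeft | Stay | MoveRight

text \<open>States and tape symbols are initial segments of the natural numbers; symbol 0 is the
  blank. Only the values of the transition function on states below \<open>tm_states\<close> and on lists of
  \<open>tm_tapes\<close> symbols below \<open>tm_symbols\<close> matter, so that a machine is a finite object.\<close>

record tm =
  tm_tapes :: nat
  tm_symbols :: nat
  tm_states :: nat
  tm_start :: nat
  tm_accept :: nat
  tm_reject :: nat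
  tm_delta :: "nat \<Rightarrow> nat list \<Rightarrow> nat \<times> (nat \<times> move) list"

definition wf_tm :: "tm \<Rightarrow> bool" where
  "wf_tm M \<longleftrightarrow>
     tm_tapes M \<ge> 1 \<and> tm_symbols M \<ge> 3 \<and>
     tm_start M < tm_states M \<and> tm_accept M < tm_states M \<and> tm_reject M < tm_states M \<and>
     tm_accept M \<noteq> tm_reject M \<and>
     (\<forall>q ss. q < tm_states M \<longrightarrow> length ss = tm_tapes M \<longrightarrow> (\<forall>s \<in> set ss. s < tm_symbols M) \<longrightarrow>
        fst (tm_delta M q ss) < tm_states M \<and>
        length (snd (tm_delta M q ss)) = tm_tapes M \<and>
        (\<forall>(s, m) \<in> set (snd (tm_delta M q ss)). s < tm_symbols M))"

text \<open>A tape is infinite in both directions and comes with the position of its head.\<close>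

type_synonym tape = "(int \<Rightarrow> nat) \<times> int"

type_synonym tm_config = "nat \<times> tape list"

fun tape_read :: "tape \<Rightarrow> nat" where
  "tape_read (c, h) = c h"

fun tape_act :: "nat \<times> move \<Rightarrow> tape \<Rightarrow> tape" where
  "tape_act (s, m) (c, h) =
     (c(h := s), case m of MoveLeft \<Rightarrow> h - 1 | Stay \<Rightarrow> h | MoveRight \<Rightarrow> h + 1)"

fun tm_step :: "tm \<Rightarrow> tm_config \<Rightarrow> tm_config" where
  "tm_step M (q, ts) =
     (if q = tm_accept M \<or> q = tm_reject M then (q, ts)
      else (case tm_delta M q (map tape_read ts) of
              (q', as) \<Rightarrow> (q', map2 tape_act as ts)))"

fun symbol_of_bit :: "bool \<Rightarrow> nat" where
  "symbol_of_bit False = 1"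
| "symbol_of_bit True = 2"

definition input_tape :: "bool list \<Rightarrow> tape" where
  "input_tape w =
     (\<lambda>i. if 0 \<le> i \<and> i < int (length w) then symbol_of_bit (w ! nat i) else 0, 0)"

definition blank_tape :: tape where
  "blank_tape = (\<lambda>_. 0, 0)"

definition tm_initial :: "tm \<Rightarrow> bool list \<Rightarrow> tm_config" where
  "tm_initial M w = (tm_start M, input_tape w # replicate (tm_tapes M - 1) blank_tape)"

definition tm_state_after :: "tm \<Rightarrow> bool list \<Rightarrow> nat \<Rightarrow> nat" where
  "tm_state_after M w t = fst ((tm_step M ^^ t) (tm_initial M w))"


section \<open>Polynomial-time solvable decision problems\<close>

record 'i decision_problem =
  instances :: "'i set"
  question :: "'i \<Rightarrow> bool"
  encoding :: "'i \<Rightarrow> bool list"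

definition polynomial_time_solvable :: "'i decision_problem \<Rightarrow> bool" where
  "polynomial_time_solvable X \<longleftrightarrow>
     (\<exists>(M :: tm) (p :: nat poly). wf_tm M \<and>
        (\<forall>x \<in> instances X. \<exists>t \<le> poly p (length (encoding X x)).
           tm_state_after M (encoding X x) t =
             (if question X x then tm_accept M else tm_reject M)))"


section \<open>The induced subdivision problem for oriented graphs\<close>

text \<open>A digraph with vertex set \<open>{0..<n}\<close> is encoded by \<open>n\<close> in unary, a separating zero, and
  its adjacency matrix row by row.\<close>

definition encode_digraph :: "nat pair_pre_digraph \<Rightarrow> bool list" where
  "encode_digraph G =
     (let n = card (pverts G)
      in replicate n True @ [False] @
         concat (map (\<lambda>u. map (\<lambda>v. (u, v) \<in> parcs G) [0..<n]) [0..<n]))"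

text \<open>As every finite digraph is isomorphic to one on some \<open>{0..<n}\<close>, only digraphs of this
  form are taken as instances.\<close>

definition induced_subdivision_problem ::
    "'a pair_pre_digraph \<Rightarrow> nat pair_pre_digraph decision_problem" where
  "induced_subdivision_problem D =
     \<lparr> instances = {G. oriented_graph G \<and> (\<exists>n. pverts G = {0..<n})},
       question = has_induced_subdivision D,
       encoding = encode_digraph \<rparr>"

end

theory Submission
  imports Defs
begin

text \<open>A shortest directed cycle of an oriented graph has no chords, since a chord would close a
  shorter cycle, and at least three vertices. So an induced subdivision of \<open>C3\<close> exists iff the
  graph has a directed cycle at all, which a Turing machine can test as
  follows: starting from the set of
  all \<open>n\<close> vertices, replace \<open>n\<close> times the current set \<open>S\<close> by the set of vertices with an
  out-neighbour in \<open>S\<close>. If there is a cycle, its vertices always survive; otherwise each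
  replacement of a nonempty set removes a sink of \<open>S\<close>, so that the final set is empty.\<close>


section \<open>Induced cycles\<close>

lemma relpow_path:
  assumes "\<And>l. i \<le> l \<Longrightarrow> l < j \<Longrightarrow> (f l, f (Suc l)) \<in> R" "i \<le> j"
  shows "(f i, f j) \<in> R ^^ (j - i)"
  unfolding relpow_fun_conv
  by (rule exI[of _ "\<lambda>l. f (i + l)"]) (use assms in auto)

text \<open>Take a closed walk of minimal positive length \<open>k\<close>: a repeated vertex or a
  chord would close a shorter one. The last equivalence thus yields both the arcs of the cycle and
  the absence of chords. It has \<open>f j = f (Suc i)\<close> instead of \<open>j = Suc i\<close>
  because \<open>i = k - 1\<close> wraps around to \<open>f k = f 0\<close>.\<close>

lemma shortest_cycle:
  assumes "\<not> acyclic R"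
  obtains k f where "0 < k" "f k = f 0" "inj_on f {..<k}"
    "\<And>i j. i < k \<Longrightarrow> j < k \<Longrightarrow> (f i, f j) \<in> R \<longleftrightarrow> f j = f (Suc i)"
proof -
  define k where "k = (LEAST k. 0 < k \<and> (\<exists>u. (u, u) \<in> R ^^ k))"
  have "\<exists>k. 0 < k \<and> (\<exists>u. (u, u) \<in> R ^^ k)"
    using assms unfolding acyclic_def trancl_power by blast
  then have k: "0 < k \<and> (\<exists>u. (u, u) \<in> R ^^ k)"
    unfolding k_def by (rule LeastI_ex)
  have minimal: "k \<le> l" if "(u, u) \<in> R ^^ l" "0 < l" for l u
    unfolding k_def using that by (intro Least_le) auto
  obtain f where f: "f k = f 0" "\<And>i. i < k \<Longrightarrow> (f i, f (Suc i)) \<in> R"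
    using k unfolding relpow_fun_conv by auto
  have path: "(f i, f j) \<in> R ^^ (j - i)" if "i \<le> j" "j \<le> k" for i j
    using f(2) that by (intro relpow_path) auto
  have inj: "inj_on f {..<k}"
  proof (rule linorder_inj_onI)
    fix i j assume "i < j" "i \<in> {..<k}" "j \<in> {..<k}"
    then show "f i \<noteq> f j"
      using path[of i j] minimal[of "f i" "j - i"] by auto
  qed auto
  have succ: "f j = f (Suc i)" if ij: "i < k" "j < k" "(f i, f j) \<in> R" for i j
  proof (cases "j \<le> i")
    case True
    \<comment> \<open>A backward arc closes up with the segment from \<open>f j\<close> to
      \<open>f i\<close>; its length \<open>i - j + 1\<close> is at least \<open>k\<close> only for
      \<open>j = 0\<close> and \<open>i = k - 1\<close>.\<close>
    then have "(f i, f i) \<in> R ^^ Suc (i - j)"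
      using relpow_Suc_I2[OF ij(3) path[of j i]] ij by simp
    from minimal[OF this] have "k \<le> Suc (i - j)" by simp
    then have "j = 0" "Suc i = k" using ij True by auto
    then show ?thesis using f(1) by simp
  next
    case False
    \<comment> \<open>A forward arc closes up by going on from \<open>f j\<close> through
      \<open>f k = f 0\<close> to \<open>f i\<close>; minimality of \<open>k\<close> then leaves
      only \<open>j = Suc i\<close>.\<close>
    have "(f j, f i) \<in> R ^^ (k - j + i)"
      using relcompI[OF path[of j k] path[of 0 i, folded f(1)]] ij by (simp add: relpow_add del: Nat.add_diff_assoc2 Nat.add_diff_assoc)
    then have "(f i, f i) \<in> R ^^ Suc (k - j + i)"
      by (rule relpow_Suc_I2[OF ij(3)])
    from minimal[OF this] have "j = Suc i" using ij False by simp
    then show ?thesis by simp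
  qed
  show ?thesis
    using that[of k f] k f inj succ by metis
qed

lemma cas_trancl:
  assumes "pre_digraph.cas (with_proj G) u p v" "p \<noteq> []" "set p \<subseteq> R"
  shows "(u, v) \<in> R\<^sup>+"
proof -
  have "(u, v) \<in> R\<^sup>*" if "pcas u p v" "set p \<subseteq> R" for u p
    using that by (induction p arbitrary: u) (auto intro: converse_rtrancl_into_rtrancl)
  then show ?thesis
    using assms unfolding cas_with_proj_eq by (cases p) (auto intro: rtrancl_into_trancl2)
qed

lemma cas_map_upt:
  assumes "i \<le> j"
  shows "pcas (f i) (map (\<lambda>l. (f l, f (Suc l))) [i..<j]) (f j)"
  using assms by (induction i rule: inc_induct) (simp_all add: upt_conv_Cons)

text \<open>The three nonempty paths of a subdivision concatenate to a closed walk. Conversely, a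
  shortest cycle has length at least 3, as loops and 2-cycles are excluded, and being chordless it
  is itself an induced subdivision.\<close>

lemma has_induced_subdivision_C3_iff:
  assumes "oriented_graph G"
  shows "has_induced_subdivision C3 G \<longleftrightarrow> \<not> acyclic (parcs G)"
proof
  assume "has_induced_subdivision C3 G"
  then obtain H where H: "induced_subgraph (with_proj H) (with_proj G)"
    and "is_subdivision C3 H"
    unfolding has_induced_subdivision_def by blast
  from this(2) obtain f P where P: "\<forall>(a, b) \<in> parcs C3. pre_digraph.apath (with_proj H) (f a) (P (a, b)) (f b) \<and>
      length (P (a, b)) \<ge> 1"
    unfolding is_subdivision_def by (elim exE conjE) (rule that)
  have sub: "parcs H \<subseteq> parcs G"
    using H by (auto simp: induced_subgraph_def subgraph_def)
  have "(f a, f b) \<in> (parcs G)\<^sup>+" if "(a, b) \<in> parcs C3" for a b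
  proof -
    have "pre_digraph.awalk (with_proj H) (f a) (P (a, b)) (f b)" "P (a, b) \<noteq> []"
      using P that by (auto simp: pre_digraph.apath_def)
    then show ?thesis
      using sub by (intro cas_trancl[of H]) (auto simp: pre_digraph.awalk_def)
  qed
  from this[of 0 1] this[of 1 2] this[of 2 0] have "(f 0, f 0) \<in> (parcs G)\<^sup>+"
    by (auto simp: C3_def)
  then show "\<not> acyclic (parcs G)" unfolding acyclic_def by blast
next
  assume "\<not> acyclic (parcs G)"
  then obtain k and f :: "nat \<Rightarrow> 'a" where k: "0 < k" "f k = f 0" and inj: "inj_on f {..<k}"
    and arcs: "\<And>i j. i < k \<Longrightarrow> j < k \<Longrightarrow> (f i, f j) \<in> parcs G \<longleftrightarrow> f j = f (Suc i)"
    using shortest_cycle by blast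
  interpret pair_digraph G using assms by (simp add: oriented_graph_def)
  have arc: "(f i, f (Suc i)) \<in> parcs G" if "i < k" for i
    using arcs[OF that, of "Suc i"] arcs[OF that k(1)] k(2) that by (cases "Suc i = k") auto
  have "k \<noteq> 1" using arc[of 0] k pair_no_loops by fastforce
  moreover have "k \<noteq> 2"
  proof
    assume "k = 2"
    then have "(f 0, f 1) \<in> parcs G" "(f 1, f 0) \<in> parcs G"
      using arc[of 0] arc[of 1] k(2) by (auto simp: numeral_2_eq_2)
    then show False using assms by (auto simp: oriented_graph_def)
  qed
  ultimately have k3: "3 \<le> k" using k(1) by linarith
  define H where "H = \<lparr> pverts = f ` {..<k}, parcs = (\<lambda>l. (f l, f (Suc l))) ` {..<k} \<rparr>"
  \<comment> \<open>The branch vertices are \<open>f 0\<close>, \<open>f 1\<close>,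
    \<open>f 2\<close>. The first two arcs stay single arcs, and the arc from 2 to 0 becomes the
    rest of the cycle; it ends at index \<open>k\<close>, as \<open>f k = f 0\<close>.\<close>
  define P where "P = (\<lambda>(a :: nat, b :: nat). map (\<lambda>l. (f l, f (Suc l))) [a..<if b = 0 then k else b])"
  have verts: "pverts H = f ` {..k}" unfolding H_def using k
    by (auto simp: image_iff lessThan_Suc_atMost[symmetric] less_Suc_eq)
  \<comment> \<open>The long path ends at index \<open>k\<close>, outside the range of
    \<open>inj\<close>. If index 0 is left out, \<open>k\<close> can take its place;
    \<open>r\<close> performs this renaming.\<close>
  have inj2: "inj_on f {i..j}" if "0 < i" "j \<le> k" for i j
  proof (rule inj_onI)
    fix x y assume xy: "x \<in> {i..j}" "y \<in> {i..j}" "f x = f y"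
    define r where "r x = (if x = k then 0 else x)" for x
    have "f (r z) = f z" for z using k(2) by (simp add: r_def)
    then have "f (r x) = f (r y)" using xy(3) by metis
    then have "r x = r y" using inj xy that k(1) by (auto simp: inj_on_def r_def)
    then show "x = y" using xy that by (auto simp: r_def split: if_splits)
  qed
  \<comment> \<open>The side condition \<open>0 < i \<or> j < k\<close> excludes only the full
    cycle, whose two ends coincide.\<close>
  have path: "pre_digraph.apath (with_proj H) (f i) (map (\<lambda>l. (f l, f (Suc l))) [i..<j]) (f j)"
    if "i < j" "j \<le> k" "0 < i \<or> j < k" for i j
  proof -
    have "pre_digraph.awalk_verts (with_proj H) (f i) (map (\<lambda>l. (f l, f (Suc l))) [i..<j]) = map f [i..<Suc j]"
      using that by (simp add: pre_digraph.awalk_verts_conv del: awalk_verts_with_proj_eq)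
         (auto simp: last_map)
    moreover have "inj_on f {i..j}"
      using that inj2[of i j] inj by (auto elim: inj_on_subset)
    ultimately have "distinct (pre_digraph.awalk_verts (with_proj H) (f i) (map (\<lambda>l. (f l, f (Suc l))) [i..<j]))"
      using that by (simp add: distinct_map atLeastLessThanSuc_atLeastAtMost del: awalk_verts_with_proj_eq upt_Suc)
    moreover have "set (map (\<lambda>l. (f l, f (Suc l))) [i..<j]) \<subseteq> parcs H"
      using that by (auto simp: H_def)
    ultimately show ?thesis
      using cas_map_upt[of i j f] that verts
      by (auto simp: pre_digraph.apath_def pre_digraph.awalk_def)
  qed
  have internal: "internal_verts (map (\<lambda>l. (f l, f (Suc l))) [i..<j]) = f ` {Suc i..<j}"
    if "i < j" for i j
  proof -
    obtain j' where "j = Suc j'" using \<open>i < j\<close> by (cases j) auto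
    then have "internal_verts (map (\<lambda>l. (f l, f (Suc l))) [i..<j]) = (\<lambda>l. f (Suc l)) ` {i..<j'}"
      using that by (simp add: internal_verts_def image_image)
    also have "\<dots> = f ` {Suc i..<j}"
      using \<open>j = Suc j'\<close> by (simp add: image_image flip: image_Suc_atLeastLessThan)
    finally show ?thesis .
  qed
  \<comment> \<open>The first splitting groups the arcs by the three paths; the second separates the
    branch vertices from the internal vertices of the long path.\<close>
  have split: "{..<k} = {0} \<union> {1} \<union> {2..<k}" "{..<k} = {0, 1, 2} \<union> {3..<k}"
    using k3 by auto
  have "is_subdivision C3 H"
    unfolding is_subdivision_def
  proof (intro exI conjI)
    show "inj_on f (pverts C3)"
      by (rule inj_on_subset[OF inj]) (use k3 in \<open>auto simp: C3_def\<close>)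
    show "\<forall>(a, b) \<in> parcs C3. pre_digraph.apath (with_proj H) (f a) (P (a, b)) (f b) \<and>
        length (P (a, b)) \<ge> 1"
      using path[of 0 1] path[of 1 2] path[of 2 k] k k3 by (auto simp: C3_def P_def)
    have P: "internal_verts (P (0, 1)) = {}" "internal_verts (P (1, 2)) = {}"
      "internal_verts (P (2, 0)) = f ` {3..<k}"
      using internal[of 0 1] internal[of 1 2] internal[of 2 k] k3 by (auto simp: P_def)
    have "f ` {3..<k} \<inter> f ` {0, 1, 2} = f ` ({3..<k} \<inter> {0, 1, 2})"
      using k3 by (intro inj_on_image_Int[OF inj, symmetric]) auto
    then have disj: "f ` {3..<k} \<inter> f ` {0, 1, 2} = {}" by auto
    show "\<forall>e \<in> parcs C3. internal_verts (P e) \<inter> f ` pverts C3 = {}"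
      unfolding C3_def using P disj by (simp del: image_insert)
    show "\<forall>e \<in> parcs C3. \<forall>e' \<in> parcs C3. e \<noteq> e' \<longrightarrow>
        internal_verts (P e) \<inter> internal_verts (P e') = {}"
      unfolding C3_def using P by simp
    show "pverts H = f ` pverts C3 \<union> (\<Union>e \<in> parcs C3. internal_verts (P e))"
      unfolding C3_def H_def split(2) using P by (simp add: image_Un)
    show "parcs H = (\<Union>e \<in> parcs C3. set (P e))"
    proof -
      have "{0..<1} = {0 :: nat}" "{1..<2} = {1 :: nat}" by auto
      then have "set (P (0, 1)) = (\<lambda>l. (f l, f (Suc l))) ` {0}"
        "set (P (1, 2)) = (\<lambda>l. (f l, f (Suc l))) ` {1}"
        "set (P (2, 0)) = (\<lambda>l. (f l, f (Suc l))) ` {2..<k}"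
        by (simp_all add: P_def)
      then show ?thesis
        unfolding C3_def H_def split(1) image_Un by simp
    qed
  qed
  moreover have "induced_subgraph (with_proj H) (with_proj G)"
  proof -
    have fG: "f i \<in> pverts G" if "i < k" for i using arc[OF that] by (rule in_arcsD1)
    have "wf_digraph (with_proj H)"
      using verts by (unfold_locales) (auto simp: H_def)
    moreover have "parcs H = {e \<in> parcs G. fst e \<in> pverts H \<and> snd e \<in> pverts H}"
    proof (intro equalityI subsetI)
      fix e assume "e \<in> parcs H"
      then show "e \<in> {e \<in> parcs G. fst e \<in> pverts H \<and> snd e \<in> pverts H}"
        using arc verts by (auto simp: H_def)
    next
      \<comment> \<open>Chordlessness enters here: by \<open>arcs\<close>, an arc of
        \<open>G\<close> between two cycle vertices is an arc of the cycle.\<close>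
      fix e assume "e \<in> {e \<in> parcs G. fst e \<in> pverts H \<and> snd e \<in> pverts H}"
      then obtain i j where "i < k" "j < k" "e = (f i, f j)" "(f i, f j) \<in> parcs G"
        by (cases e) (auto simp: H_def)
      then show "e \<in> parcs H" using arcs by (auto simp: H_def)
    qed
    ultimately show ?thesis
      using fG wf_digraph by (auto simp: induced_subgraph_def subgraph_def H_def)
  qed
  ultimately show "has_induced_subdivision C3 G"
    unfolding has_induced_subdivision_def by blast
qed

section \<open>Iterated predecessor sets and acyclicity\<close>

definition pred_set :: "nat \<Rightarrow> (nat \<times> nat) set \<Rightarrow> nat set \<Rightarrow> nat set" where
  "pred_set n R S = {u. u < n \<and> (\<exists>v<n. v \<in> S \<and> (u, v) \<in> R)}"

lemma pred_set_mono: "mono (pred_set n R)"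
  unfolding pred_set_def by (rule monoI) blast

text \<open>A finite acyclic relation has a well-founded converse; a minimal element of
  \<open>S\<close> for it is a sink of \<open>S\<close> and drops out.\<close>

lemma pred_set_psubset:
  assumes "acyclic R" "R \<subseteq> {..<n} \<times> {..<n}" "S \<subseteq> {..<n}" "S \<noteq> {}" "pred_set n R S \<subseteq> S"
  shows "pred_set n R S \<subset> S"
proof -
  have "finite R" using assms(2) by (rule finite_subset) simp
  then have "wf (R\<inverse>)" using assms(1) by (rule finite_acyclic_wf_converse)
  then obtain x where "x \<in> S" "\<And>y. (y, x) \<in> R\<inverse> \<Longrightarrow> y \<notin> S"
    using assms(4) by (metis all_not_in_conv wfE_min)
  then have "x \<notin> pred_set n R S" by (auto simp: pred_set_def)
  then show ?thesis using \<open>x \<in> S\<close> assms(5) by blast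
qed

text \<open>In the acyclic case every round costs at least one vertex until none is left, so
  \<open>n\<close> rounds suffice; otherwise the vertices on closed walks survive every
  round.\<close>

lemma pred_set_iterate_empty_iff:
  assumes "R \<subseteq> {..<n} \<times> {..<n}"
  shows "(pred_set n R ^^ n) UNIV \<inter> {..<n} = {} \<longleftrightarrow> acyclic R"
proof
  assume "acyclic R"
  define S where "S k = (pred_set n R ^^ k) UNIV \<inter> {..<n}" for k
  \<comment> \<open>The bound \<open>v<n\<close> inside \<open>pred_set\<close> makes the part of a
    set above \<open>n\<close> irrelevant, so starting from \<open>UNIV\<close> amounts to starting
    from \<open>{..<n}\<close>.\<close>
  have S_Suc: "S (Suc k) = pred_set n R (S k)" for k
    by (auto simp: S_def pred_set_def)
  have dec: "S (Suc k) \<subseteq> S k" for k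
  proof (induction k)
    case (Suc k)
    then show ?case using monoD[OF pred_set_mono] by (metis S_Suc)
  qed (auto simp: S_def)
  have "card (S k) \<le> n - k" for k
  proof (induction k)
    case 0
    show ?case by (simp add: S_def)
  next
    case (Suc k)
    show ?case
    proof (cases "S k = {}")
      case True
      then show ?thesis using dec[of k] by simp
    next
      case False
      have "S (Suc k) \<subset> S k"
        using pred_set_psubset[OF \<open>acyclic R\<close> assms _ False] dec[of k] S_Suc
        by (auto simp: S_def)
      then have "card (S (Suc k)) < card (S k)"
        by (intro psubset_card_mono) (auto simp: S_def)
      then show ?thesis using Suc.IH by linarith
    qed
  qed
  from this[of n] show "(pred_set n R ^^ n) UNIV \<inter> {..<n} = {}"
    by (simp add: S_def)
next
  assume empty: "(pred_set n R ^^ n) UNIV \<inter> {..<n} = {}"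
  have bound: "u < n" if "(u, u) \<in> R\<^sup>+" for u
    using tranclD[OF that] assms by auto
  \<comment> \<open>The successor of a vertex along a closed walk lies on a closed walk again, so
    this set is contained in its own predecessor set.\<close>
  have "{u. (u, u) \<in> R\<^sup>+} \<subseteq> (pred_set n R ^^ k) UNIV" for k
  proof (induction k)
    case (Suc k)
    show ?case
    proof
      fix u assume "u \<in> {u. (u, u) \<in> R\<^sup>+}"
      then obtain v where v: "(u, v) \<in> R" "(v, u) \<in> R\<^sup>*" by (auto dest: tranclD)
      then have "(v, v) \<in> R\<^sup>+" by (rule_tac rtrancl_into_trancl1)
      then have "v \<in> (pred_set n R ^^ k) UNIV" using Suc.IH by blast
      then show "u \<in> (pred_set n R ^^ Suc k) UNIV"
        using v(1) assms by (auto simp: pred_set_def[of _ _ "(_ ^^ _) _"])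
    qed
  qed simp
  from this[of n] show "acyclic R"
    using empty bound unfolding acyclic_def by auto
qed


section \<open>A Turing machine testing acyclicity\<close>

definition reaches_within :: "tm \<Rightarrow> nat \<Rightarrow> tm_config \<Rightarrow> tm_config \<Rightarrow> bool" where
  "reaches_within M k x y \<longleftrightarrow> (\<exists>t\<le>k. (tm_step M ^^ t) x = y)"

lemma reaches_within_refl: "reaches_within M k x x"
  unfolding reaches_within_def by (rule exI[of _ 0]) simp

lemma reaches_within_trans:
  assumes "reaches_within M k x y" "reaches_within M l y z" "k + l \<le> m"
  shows "reaches_within M m x z"
proof -
  obtain s t where "s \<le> k" "(tm_step M ^^ s) x = y" "t \<le> l" "(tm_step M ^^ t) y = z"
    using assms(1,2) unfolding reaches_within_def by blast
  then have "(tm_step M ^^ (t + s)) x = z" "t + s \<le> m"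
    using assms(3) by (auto simp: funpow_add)
  then show ?thesis unfolding reaches_within_def by blast
qed

text \<open>The premises are ordered for \<open>OF\<close>: the rest of the run, often an induction
  hypothesis, comes first, which leaves one machine step and an inequality to the
  simplifier.\<close>

lemma reaches_within_step:
  assumes "reaches_within M k y z" "tm_step M x = y" "Suc k \<le> m"
  shows "reaches_within M m x z"
proof -
  have "reaches_within M 1 x y"
    unfolding reaches_within_def using assms(2) by (intro exI[of _ 1]) simp
  then show ?thesis using assms(1) by (rule reaches_within_trans) (use assms(3) in simp)
qed

text \<open>The states are phases. \<open>q_init\<close> reads the unary prefix.
  \<open>q_scan\<close> and \<open>q_found\<close> read a matrix row, the state remembering whether
  an out-neighbour in the current set was met. \<open>q_row_end\<close> leads either to the next row
  through \<open>q_rewind_row\<close>, or to \<open>q_copy\<close>, which makes the next set the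
  current one, and \<open>q_rewind\<close>, which returns the input head to the separator.
  \<open>q_final\<close> looks for a surviving vertex.\<close>

abbreviation (input) "q_init \<equiv> 0 :: nat"
abbreviation (input) "q_scan \<equiv> 1 :: nat"
abbreviation (input) "q_found \<equiv> 2 :: nat"
abbreviation (input) "q_row_end \<equiv> 3 :: nat"
abbreviation (input) "q_rewind_row \<equiv> 4 :: nat"
abbreviation (input) "q_copy \<equiv> 5 :: nat"
abbreviation (input) "q_rewind \<equiv> 6 :: nat"
abbreviation (input) "q_final \<equiv> 7 :: nat"
abbreviation (input) "q_accept \<equiv> 8 :: nat"
abbreviation (input) "q_reject \<equiv> 9 :: nat"

text \<open>Tape 0 holds the input, with the separator overwritten by 3. The cells \<open>0..<n\<close> of tapes 1
  and 2 hold the current and the next vertex set (2 for members, 1 for non-members), indexed by the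
  columns and the rows of the matrix, respectively. The head of tape 3 counts the rounds.\<close>

definition cycle_delta :: "nat \<Rightarrow> nat list \<Rightarrow> nat \<times> (nat \<times> move) list" where
  "cycle_delta q ss =
     (let i = ss ! 0; a = ss ! 1; b = ss ! 2; c = ss ! 3 in
      if q = q_init then
        if i = 2 then (q_init, [(i, MoveRight), (a, MoveRight), (2, MoveRight), (2, MoveRight)])
        else (q_copy, [(3, Stay), (a, MoveLeft), (b, MoveLeft), (c, MoveLeft)])
      else if q = q_scan \<or> q = q_found then
        if a = 0 then
          (q_row_end, [(i, Stay), (a, Stay), (if q = q_found then 2 else 1, MoveRight), (c, Stay)])
        else
          (if i = 2 \<and> a = 2 then q_found else q,
           [(i, MoveRight), (a, MoveRight), (b, Stay), (c, Stay)])
      else if q = q_row_end then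
        if b = 0 then (q_copy, [(i, Stay), (a, MoveLeft), (b, MoveLeft), (c, Stay)])
        else (q_rewind_row, [(i, Stay), (a, MoveLeft), (b, Stay), (c, Stay)])
      else if q = q_rewind_row then
        if a = 0 then (q_scan, [(i, Stay), (a, MoveRight), (b, Stay), (c, Stay)])
        else (q_rewind_row, [(i, Stay), (a, MoveLeft), (b, Stay), (c, Stay)])
      else if q = q_copy then
        if b = 0 then (q_rewind, [(i, Stay), (a, MoveRight), (b, MoveRight), (c, Stay)])
        else (q_copy, [(i, Stay), (b, MoveLeft), (b, MoveLeft), (c, Stay)])
      else if q = q_rewind then
        if i \<noteq> 3 then (q_rewind, [(i, MoveLeft), (a, Stay), (b, Stay), (c, Stay)])
        else if c = 0 then (q_final, [(i, Stay), (a, Stay), (b, Stay), (c, Stay)])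
        else (q_scan, [(i, MoveRight), (a, Stay), (b, Stay), (c, MoveLeft)])
      else
        (if a = 0 then q_reject else if a = 2 then q_accept else q_final,
         [(i, Stay), (a, MoveRight), (b, Stay), (c, Stay)]))"

definition cycle_tm :: tm where
  "cycle_tm = \<lparr> tm_tapes = 4, tm_symbols = 4, tm_states = 10, tm_start = q_init,
     tm_accept = q_accept, tm_reject = q_reject, tm_delta = cycle_delta \<rparr>"

lemma wf_cycle_tm: "wf_tm cycle_tm"
proof -
  have "fst (cycle_delta q ss) < 10 \<and> length (snd (cycle_delta q ss)) = 4 \<and>
      (\<forall>(s, m) \<in> set (snd (cycle_delta q ss)). s < 4)"
    if "q < 10" "length ss = 4" "\<forall>s \<in> set ss. s < 4" for q ss
  proof -
    have "ss ! 0 < 4" "ss ! 1 < 4" "ss ! 2 < 4" "ss ! 3 < 4"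
      using that(2,3) by auto
    then show ?thesis
      using that(1) unfolding cycle_delta_def Let_def by auto
  qed
  then show ?thesis
    unfolding wf_tm_def cycle_tm_def by simp
qed

section \<open>Tape contents and the single phases\<close>

abbreviation (input) cycle_config ::
    "nat \<Rightarrow> (int \<Rightarrow> nat) \<Rightarrow> int \<Rightarrow> (int \<Rightarrow> nat) \<Rightarrow> int \<Rightarrow> (int \<Rightarrow> nat) \<Rightarrow> int \<Rightarrow> (int \<Rightarrow> nat) \<Rightarrow> int \<Rightarrow> tm_config"
  where "cycle_config q I i A a B b C c \<equiv> (q, [(I, i), (A, a), (B, b), (C, c)])"

text \<open>Most transitions write back the symbol just read; \<open>fun_upd_idem\<close> removes
  these trivial updates.\<close>

lemmas cycle_step = cycle_tm_def cycle_delta_def Let_def fun_upd_idem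

text \<open>The blanks on both sides act as end markers for the heads.\<close>

definition set_tape :: "nat \<Rightarrow> nat set \<Rightarrow> int \<Rightarrow> nat" where
  "set_tape n S = (\<lambda>i. if 0 \<le> i \<and> i < int n then if nat i \<in> S then 2 else 1 else 0)"

lemma set_tape_eq_0: "set_tape n S i = 0 \<longleftrightarrow> i < 0 \<or> int n \<le> i"
  by (auto simp: set_tape_def)

text \<open>Tapes 2 and 3 are filled with \<open>n\<close> twos while tape 1 stays blank. Ending in
  \<open>q_copy\<close> lets the ordinary copying phase put the full vertex set on tape 1, and the
  twos on tape 3 allow exactly \<open>n\<close> rounds.\<close>

lemma init_reaches:
  assumes "\<And>j. j < n \<Longrightarrow> I (int j) = 2" "I (int n) = 1" "k \<le> n" "m = Suc (n - k)"
  shows "reaches_within cycle_tm m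
           (cycle_config q_init I (int k) (\<lambda>_. 0) (int k)
              (set_tape k UNIV) (int k) (set_tape k UNIV) (int k))
           (cycle_config q_copy (I(int n := 3)) (int n) (\<lambda>_. 0) (int n - 1)
              (set_tape n UNIV) (int n - 1) (set_tape n UNIV) (int n - 1))"
  using assms(3,4)
proof (induction k arbitrary: m rule: inc_induct)
  case base
  show ?case
    by (rule reaches_within_step[OF reaches_within_refl[of _ 0]])
       (use assms(2) base in \<open>simp_all add: cycle_step set_tape_eq_0 fun_upd_def\<close>)
next
  case (step k)
  have *: "(set_tape k UNIV)(int k := 2) = set_tape (Suc k) UNIV"
    by (auto simp: set_tape_def fun_eq_iff)
  show ?case
    by (rule reaches_within_step[OF step.IH[OF refl]])
       (use assms(1)[of k] step.hyps step.prems in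
          \<open>simp_all add: cycle_step * algebra_simps\<close>)
qed

text \<open>Copying runs from right to left. The invariant is that \<open>A\<close> can differ from
  \<open>B\<close> only in the cells \<open>0..<k\<close> not yet visited, so \<open>A = B\<close>
  once the head reaches the blank at \<open>-1\<close>.\<close>

lemma copy_reaches:
  assumes "\<And>j. B j = 0 \<longleftrightarrow> j < 0 \<or> int n \<le> j"
    and "k \<le> n" "\<And>j. j < 0 \<or> int k \<le> j \<Longrightarrow> A j = B j" "m = Suc k"
  shows "reaches_within cycle_tm m
           (cycle_config q_copy I i A (int k - 1) B (int k - 1) C c)
           (cycle_config q_rewind I i B 0 B 0 C c)"
  using assms(2-4)
proof (induction k arbitrary: A m)
  case 0
  have "A j = B j" for j by (rule 0(2)) auto
  then have "A = B" ..
  moreover have "B (- 1) = 0" using assms(1)[of "-1"] by simp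
  ultimately show ?case
    by (intro reaches_within_step[OF reaches_within_refl[of _ 0]])
       (use 0 in \<open>simp_all add: cycle_step\<close>)
next
  case (Suc k)
  have "B (int k) \<noteq> 0" using assms(1)[of "int k"] Suc.prems(1) by simp
  moreover have "(A(int k := B (int k))) j = B j" if "j < 0 \<or> int k \<le> j" for j
    using that Suc.prems(2)[of j] by auto
  ultimately show ?case
    by (intro reaches_within_step[OF Suc.IH[OF _ _ refl, of "A(int k := B (int k))"]])
       (use Suc.prems in \<open>simp_all add: cycle_step fun_upd_def\<close>)
qed

lemma rewind_row_reaches:
  assumes "\<And>j. A j = 0 \<longleftrightarrow> j < 0 \<or> int n \<le> j" "k \<le> n" "m = Suc k"
  shows "reaches_within cycle_tm m
           (cycle_config q_rewind_row I i A (int k - 1) B b C c)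
           (cycle_config q_scan I i A 0 B b C c)"
  using assms(2,3)
proof (induction k arbitrary: m)
  case 0
  have "A (- 1) = 0" using assms(1)[of "-1"] by simp
  then show ?case
    by (intro reaches_within_step[OF reaches_within_refl[of _ 0]])
       (use 0 in \<open>simp_all add: cycle_step\<close>)
next
  case (Suc k)
  have "A (int k) \<noteq> 0" using assms(1)[of "int k"] Suc.prems(1) by simp
  then show ?case
    by (intro reaches_within_step[OF Suc.IH[OF _ refl]])
       (use Suc.prems in \<open>simp_all add: cycle_step\<close>)
qed

lemma rewind_reaches:
  assumes "\<And>j. 0 < j \<Longrightarrow> j \<le> k \<Longrightarrow> I (i + int j) \<noteq> 3"
  shows "reaches_within cycle_tm k
           (cycle_config q_rewind I (i + int k) A a B b C c)
           (cycle_config q_rewind I i A a B b C c)"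
  using assms
proof (induction k)
  case 0
  show ?case by (simp add: reaches_within_refl)
next
  case (Suc k)
  have "I (i + int (Suc k)) \<noteq> 3" using Suc.prems by blast
  then have *: "I (1 + (i + int k)) \<noteq> 3" by (simp add: algebra_simps)
  show ?case
    by (rule reaches_within_step[OF Suc.IH])
       (use * Suc.prems in \<open>auto simp: cycle_step algebra_simps\<close>)
qed

text \<open>The final tapes are quantified away, since acceptance depends on the state
  alone.\<close>

lemma final_reaches:
  assumes "k \<le> n" "m = Suc (n - k)"
  shows "\<exists>ts. reaches_within cycle_tm m
           (cycle_config q_final I i (set_tape n S) (int k) B b C c)
           (if \<exists>v. k \<le> v \<and> v < n \<and> v \<in> S then q_accept else q_reject, ts)"
  using assms
proof (induction k arbitrary: m rule: inc_induct)
  case base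
  have "set_tape n S (int n) = 0" by (simp add: set_tape_def)
  then show ?case
    by (intro exI, intro reaches_within_step[OF reaches_within_refl[of _ 0]])
       (use base in \<open>simp_all add: cycle_step\<close>)
next
  case (step k)
  show ?case
  proof (cases "k \<in> S")
    case True
    then have *: "set_tape n S (int k) = 2" "\<exists>v\<ge>k. v < n \<and> v \<in> S"
      using step.hyps by (auto simp: set_tape_def)
    show ?thesis
      by (intro exI, intro reaches_within_step[OF reaches_within_refl[of _ 0]])
         (use * step.hyps step.prems in \<open>simp_all add: cycle_step\<close>)
  next
    case False
    then have *: "set_tape n S (int k) = 1"
      using step.hyps by (auto simp: set_tape_def)
    have **: "(\<exists>v\<ge>k. v < n \<and> v \<in> S) \<longleftrightarrow> (\<exists>v\<ge>Suc k. v < n \<and> v \<in> S)"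
      using False by (metis Suc_leD le_antisym not_less_eq_eq)
    obtain ts where "reaches_within cycle_tm (Suc (n - Suc k))
           (cycle_config q_final I i (set_tape n S) (int (Suc k)) B b C c)
           (if \<exists>v\<ge>Suc k. v < n \<and> v \<in> S then q_accept else q_reject, ts)"
      using step.IH[OF refl] by blast
    then show ?thesis
      unfolding **
      by (intro exI, rule reaches_within_step)
         (use * step.hyps step.prems in \<open>simp_all add: cycle_step algebra_simps\<close>)
  qed
qed

section \<open>Rounds of the machine on a fixed input tape\<close>

context
  fixes n :: nat and R :: "(nat \<times> nat) set" and I :: "int \<Rightarrow> nat"
  assumes separator: "I (int n) = 3"
    and matrix: "\<And>u v. u < n \<Longrightarrow> v < n \<Longrightarrow>
      I (int (Suc n + n * u + v)) = (if (u, v) \<in> R then 2 else 1)"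
    and input_end: "I (int (Suc n + n * n)) \<noteq> 3"
begin

text \<open>The flag \<open>f\<close> treats \<open>q_scan\<close> and \<open>q_found\<close>
  together, so the induction can switch between them. The input head ends at the start of row
  \<open>Suc u\<close> and need not move between rows.\<close>

lemma scan_reaches:
  assumes "u < n" "v \<le> n" "m = Suc (n - v)" "B (int u) \<noteq> 0"
  shows "reaches_within cycle_tm m
           (cycle_config (if f then q_found else q_scan) I (int (Suc n + n * u + v))
              (set_tape n S) (int v) B (int u) C c)
           (cycle_config q_row_end I (int (Suc n + n * Suc u)) (set_tape n S) (int n)
              (B(int u := if f \<or> (\<exists>w\<ge>v. w < n \<and> w \<in> S \<and> (u, w) \<in> R) then 2 else 1))
              (int (Suc u)) C c)"
  using assms(2,3)
proof (induction v arbitrary: f m rule: inc_induct)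
  case base
  have "set_tape n S (int n) = 0" by (simp add: set_tape_def)
  then show ?case
    by (intro reaches_within_step[OF reaches_within_refl[of _ 0]])
       (use base in \<open>auto simp: cycle_step algebra_simps\<close>)
next
  case (step v)
  let ?f = "f \<or> v \<in> S \<and> (u, v) \<in> R"
  have nz: "set_tape n S (int v) \<noteq> 0" and two: "set_tape n S (int v) = 2 \<longleftrightarrow> v \<in> S"
    using step.hyps by (auto simp: set_tape_def)
  have i: "I (int (Suc n + n * u + v)) = 2 \<longleftrightarrow> (u, v) \<in> R"
    using matrix[OF assms(1), of v] step.hyps by auto
  have ex: "?f \<or> (\<exists>w\<ge>Suc v. w < n \<and> w \<in> S \<and> (u, w) \<in> R) \<longleftrightarrow>
      f \<or> (\<exists>w\<ge>v. w < n \<and> w \<in> S \<and> (u, w) \<in> R)"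
    using step.hyps by (metis Suc_leD le_antisym le_refl not_less_eq_eq)
  show ?case
    by (rule reaches_within_step[OF step.IH[where f = ?f, OF refl, unfolded ex]])
       (use nz two i step.hyps step.prems in
          \<open>auto simp del: of_nat_Suc of_nat_add simp add: cycle_step\<close>)
qed

text \<open>Tape 2 is overwritten in place: cells below \<open>u\<close> hold the new set, later
  ones their old nonblank symbols, so the blank at \<open>n\<close> still marks the end. A row costs
  at most \<open>2 * n + 3\<close> steps. Since \<open>u < n\<close>, the base case is vacuous and
  the last row is treated in the induction step.\<close>

lemma rows_reaches:
  assumes "u \<le> n" "u < n" "m = (n - u) * (2 * n + 5)"
    and "\<And>j. B j = 0 \<longleftrightarrow> j < 0 \<or> int n \<le> j"
    and "\<And>j. j < int u \<Longrightarrow> B j = set_tape n (pred_set n R S) j"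
  shows "reaches_within cycle_tm m
           (cycle_config q_scan I (int (Suc n + n * u)) (set_tape n S) 0 B (int u) C c)
           (cycle_config q_copy I (int (Suc n + n * n)) (set_tape n S) (int n - 1)
              (set_tape n (pred_set n R S)) (int n - 1) C c)"
  using assms
proof (induction u arbitrary: B m rule: inc_induct)
  case base
  then show ?case by simp
next
  case (step u)
  let ?B = "B(int u := if \<exists>w\<ge>0. w < n \<and> w \<in> S \<and> (u, w) \<in> R then 2 else 1)"
  have u: "u < n" "B (int u) \<noteq> 0" using step.prems by auto
  have nz: "?B j = 0 \<longleftrightarrow> j < 0 \<or> int n \<le> j" for j
    using step.prems(3)[of j] u by auto
  have B: "?B j = set_tape n (pred_set n R S) j" if "j < int (Suc u)" for j
    using that u(1) step.prems(4)[of j] by (auto simp: set_tape_def pred_set_def)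
  have blank: "set_tape n S (int n) = 0" by (simp add: set_tape_def)
  have scan: "reaches_within cycle_tm (Suc n)
      (cycle_config q_scan I (int (Suc n + n * u)) (set_tape n S) 0 B (int u) C c)
      (cycle_config q_row_end I (int (Suc n + n * Suc u)) (set_tape n S) (int n)
         ?B (int (Suc u)) C c)"
    using scan_reaches[of u 0 "Suc n" B False S C c] u by simp
  show ?case
  proof (cases "Suc u = n")
    case True
    have eq: "?B = set_tape n (pred_set n R S)"
    proof
      fix j show "?B j = set_tape n (pred_set n R S) j"
        using B[of j] nz[of j] True by (cases "j < int n") (auto simp: set_tape_eq_0)
    qed
    have "reaches_within cycle_tm 1
      (cycle_config q_row_end I (int (Suc n + n * Suc u)) (set_tape n S) (int n)
         ?B (int (Suc u)) C c)
      (cycle_config q_copy I (int (Suc n + n * n)) (set_tape n S) (int n - 1)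
              (set_tape n (pred_set n R S)) (int n - 1) C c)"
      unfolding eq True using blank
      by (intro reaches_within_step[OF reaches_within_refl[of _ 0]])
         (auto simp: cycle_step set_tape_eq_0)
    then show ?thesis
      using True by (intro reaches_within_trans[OF scan]) (auto simp: step.prems(2))
  next
    case False
    then have less: "Suc u < n" using u by simp
    have "reaches_within cycle_tm (Suc (Suc n))
      (cycle_config q_row_end I (int (Suc n + n * Suc u)) (set_tape n S) (int n)
         ?B (int (Suc u)) C c)
      (cycle_config q_scan I (int (Suc n + n * Suc u)) (set_tape n S) 0 ?B (int (Suc u)) C c)"
      by (rule reaches_within_step[OF rewind_row_reaches[OF set_tape_eq_0 order_refl refl]])
         (use nz[of "int (Suc u)"] less blank in
            \<open>auto simp: cycle_step simp del: fun_upd_apply of_nat_Suc of_nat_add\<close>)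
    then have row: "reaches_within cycle_tm (2 * n + 3)
      (cycle_config q_scan I (int (Suc n + n * u)) (set_tape n S) 0 B (int u) C c)
      (cycle_config q_scan I (int (Suc n + n * Suc u)) (set_tape n S) 0 ?B (int (Suc u)) C c)"
      by (intro reaches_within_trans[OF scan]) auto
    have "n - u = Suc (n - Suc u)" using u by simp
    then have "m = (2 * n + 5) + (n - Suc u) * (2 * n + 5)" using step.prems(2) by simp
    then show ?thesis
      by (intro reaches_within_trans[OF row step.IH[OF less refl nz B]]) auto
  qed
qed

text \<open>The parts cost \<open>n * (2 * n + 5) + 1\<close> for the rows, \<open>n + 1\<close> for
  copying and \<open>n * n + 1\<close> for rewinding, which add up to exactly the stated
  bound.\<close>

lemma round_reaches:
  assumes "0 < n" "C c \<noteq> 0"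
  shows "reaches_within cycle_tm (3 * (n + 1)\<^sup>2)
           (cycle_config q_rewind I (int n) (set_tape n S) 0 (set_tape n S) 0 C c)
           (cycle_config q_rewind I (int n) (set_tape n (pred_set n R S)) 0
              (set_tape n (pred_set n R S)) 0 C (c - 1))"
    (is "reaches_within _ _ ?x ?w")
proof -
  let ?T = "set_tape n (pred_set n R S)"
  have rows: "reaches_within cycle_tm (n * (2 * n + 5) + 1) ?x
      (cycle_config q_copy I (int (Suc n + n * n)) (set_tape n S) (int n - 1)
         ?T (int n - 1) C (c - 1))"
    by (rule reaches_within_step[OF rows_reaches[of 0 _ "set_tape n S", OF _ _ refl set_tape_eq_0]])
       (use assms separator in \<open>auto simp: cycle_step set_tape_def\<close>)
  have copy: "reaches_within cycle_tm (Suc n)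
      (cycle_config q_copy I (int (Suc n + n * n)) (set_tape n S) (int n - 1)
         ?T (int n - 1) C (c - 1))
      (cycle_config q_rewind I (int (Suc n + n * n)) ?T 0 ?T 0 C (c - 1))"
    by (rule copy_reaches[OF set_tape_eq_0 order_refl]) (auto simp: set_tape_def)
  \<comment> \<open>Rewinding must not stop early. Cell \<open>n + j\<close> is the matrix entry in
    row \<open>(j - 1) div n\<close> and column \<open>(j - 1) mod n\<close>, except for the cell
    just behind the matrix, which \<open>input_end\<close> covers.\<close>
  have no_sep: "I (int n + int j) \<noteq> 3" if "0 < j" "j \<le> Suc (n * n)" for j
  proof (cases "j = Suc (n * n)")
    case True
    have "int n + int j = int (Suc n + n * n)" using True by simp
    then show ?thesis using input_end by metis
  next
    case False
    then have "(j - 1) div n < n" using that by (intro less_mult_imp_div_less) simp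
    moreover have "(j - 1) mod n < n" using assms(1) by simp
    moreover have "Suc n + n * ((j - 1) div n) + (j - 1) mod n = n + j"
      using that(1) by (simp add: add.assoc)
    ultimately show ?thesis
      using matrix[of "(j - 1) div n" "(j - 1) mod n"] by (auto simp: add.commute)
  qed
  have "reaches_within cycle_tm (Suc (n * n))
      (cycle_config q_rewind I (int n + int (Suc (n * n))) ?T 0 ?T 0 C (c - 1)) ?w"
    using no_sep by (rule rewind_reaches)
  then have to_start: "reaches_within cycle_tm (Suc (n * n))
      (cycle_config q_rewind I (int (Suc n + n * n)) ?T 0 ?T 0 C (c - 1)) ?w"
    by (simp add: algebra_simps)
  show ?thesis
    by (rule reaches_within_trans[OF rows reaches_within_trans[OF copy to_start order_refl]])
       (simp add: power2_eq_square algebra_simps)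
qed

text \<open>The counter head at \<open>k - 1\<close> has \<open>k\<close> nonblank cells left, one
  per round, and reaches the blank at \<open>-1\<close> after the last. The induction peels off the
  first round and therefore varies \<open>S\<close>.\<close>

lemma rounds_reach:
  assumes "k \<le> n"
  shows "reaches_within cycle_tm (k * (3 * (n + 1)\<^sup>2))
           (cycle_config q_rewind I (int n) (set_tape n S) 0 (set_tape n S) 0
              (set_tape n UNIV) (int k - 1))
           (cycle_config q_rewind I (int n) (set_tape n ((pred_set n R ^^ k) S)) 0
              (set_tape n ((pred_set n R ^^ k) S)) 0 (set_tape n UNIV) (- 1))"
  using assms
proof (induction k arbitrary: S)
  case 0
  show ?case by (simp add: reaches_within_refl)
next
  case (Suc k)
  have "set_tape n UNIV (int (Suc k) - 1) \<noteq> 0" using Suc.prems by (simp add: set_tape_def)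
  then have round: "reaches_within cycle_tm (3 * (n + 1)\<^sup>2)
      (cycle_config q_rewind I (int n) (set_tape n S) 0 (set_tape n S) 0
         (set_tape n UNIV) (int (Suc k) - 1))
      (cycle_config q_rewind I (int n) (set_tape n (pred_set n R S)) 0
         (set_tape n (pred_set n R S)) 0 (set_tape n UNIV) (int k - 1))"
    using round_reaches[of "set_tape n UNIV" "int (Suc k) - 1" S] Suc.prems by simp
  show ?case
    using reaches_within_trans[OF round Suc.IH[of "pred_set n R S"]] Suc.prems
    by (simp add: funpow_swap1 del: power2_eq_square)
qed

lemma search_reaches:
  "\<exists>ts. reaches_within cycle_tm (n * (3 * (n + 1)\<^sup>2) + (n + 2))
     (cycle_config q_rewind I (int n) (set_tape n S) 0 (set_tape n S) 0
        (set_tape n UNIV) (int n - 1))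
     (if (pred_set n R ^^ n) S \<inter> {..<n} \<noteq> {} then q_accept else q_reject, ts)"
proof -
  let ?T = "set_tape n ((pred_set n R ^^ n) S)"
  let ?z = "if (pred_set n R ^^ n) S \<inter> {..<n} \<noteq> {} then q_accept else q_reject"
  have "(\<exists>v<n. v \<in> (pred_set n R ^^ n) S) \<longleftrightarrow> (pred_set n R ^^ n) S \<inter> {..<n} \<noteq> {}"
    by auto
  then obtain ts where final: "reaches_within cycle_tm (Suc n)
      (cycle_config q_final I (int n) ?T 0 ?T 0 (set_tape n UNIV) (- 1)) (?z, ts)"
    using final_reaches[of 0 n "Suc n" I "int n" "(pred_set n R ^^ n) S" ?T 0 "set_tape n UNIV" "-1"]
    by simp blast
  have "set_tape n UNIV (- 1) = 0" by (simp add: set_tape_def)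
  then have "reaches_within cycle_tm (n + 2)
      (cycle_config q_rewind I (int n) ?T 0 ?T 0 (set_tape n UNIV) (- 1)) (?z, ts)"
    by (intro reaches_within_step[OF final])
       (use separator in \<open>simp_all add: cycle_step\<close>)
  from reaches_within_trans[OF rounds_reach[OF order_refl] this order_refl] show ?thesis
    by blast
qed

end

lemma cycle_tm_decides:
  assumes "\<And>j. j < n \<Longrightarrow> I (int j) = 2" "I (int n) = 1"
    and matrix: "\<And>u v. u < n \<Longrightarrow> v < n \<Longrightarrow>
      I (int (Suc n + n * u + v)) = (if (u, v) \<in> R then 2 else 1)"
    and "I (int (Suc n + n * n)) = 0"
  shows "\<exists>ts. reaches_within cycle_tm (7 * (n + 1) ^ 3)
     (cycle_config q_init I 0 (\<lambda>_. 0) 0 (\<lambda>_. 0) 0 (\<lambda>_. 0) 0)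
     (if (pred_set n R ^^ n) UNIV \<inter> {..<n} \<noteq> {} then q_accept else q_reject, ts)"
proof -
  \<comment> \<open>The input tape after the separator is overwritten; the matrix and the cell
    behind it lie beyond \<open>n\<close> and keep their symbols.\<close>
  let ?I = "I(int n := 3)"
  have blank: "set_tape 0 UNIV = (\<lambda>_. 0)" by (auto simp: set_tape_def)
  have init: "reaches_within cycle_tm (Suc n)
      (cycle_config q_init I 0 (\<lambda>_. 0) 0 (\<lambda>_. 0) 0 (\<lambda>_. 0) 0)
      (cycle_config q_copy ?I (int n) (\<lambda>_. 0) (int n - 1)
         (set_tape n UNIV) (int n - 1) (set_tape n UNIV) (int n - 1))"
    using init_reaches[of n I 0 "Suc n"] assms(1,2) by (simp add: blank)
  have copy: "reaches_within cycle_tm (Suc n)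
      (cycle_config q_copy ?I (int n) (\<lambda>_. 0) (int n - 1)
         (set_tape n UNIV) (int n - 1) (set_tape n UNIV) (int n - 1))
      (cycle_config q_rewind ?I (int n) (set_tape n UNIV) 0 (set_tape n UNIV) 0
         (set_tape n UNIV) (int n - 1))"
    by (rule copy_reaches[OF set_tape_eq_0 order_refl]) (auto simp: set_tape_def)
  have I_sep: "?I (int n) = 3" by simp
  have I_matrix: "?I (int (Suc n + n * u + v)) = (if (u, v) \<in> R then 2 else 1)"
    if "u < n" "v < n" for u v
    using matrix[OF that] by (simp only: fun_upd_apply of_nat_eq_iff) simp
  have I_end: "?I (int (Suc n + n * n)) \<noteq> 3"
    using assms(4) by (simp only: fun_upd_apply of_nat_eq_iff) simp
  obtain ts where search: "reaches_within cycle_tm (n * (3 * (n + 1)\<^sup>2) + (n + 2))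
     (cycle_config q_rewind ?I (int n) (set_tape n UNIV) 0 (set_tape n UNIV) 0
        (set_tape n UNIV) (int n - 1))
     (if (pred_set n R ^^ n) UNIV \<inter> {..<n} \<noteq> {} then q_accept else q_reject, ts)"
    using search_reaches[OF I_sep I_matrix I_end, of UNIV] by blast
  have "Suc n + (Suc n + (n * (3 * (n + 1)\<^sup>2) + (n + 2))) \<le> 7 * (n + 1) ^ 3"
    by (simp add: power2_eq_square power3_eq_cube algebra_simps)
  then show ?thesis
    using reaches_within_trans[OF init reaches_within_trans[OF copy search order_refl]] by blast
qed


section \<open>The encoding of digraphs\<close>

text \<open>All rows have length \<open>n\<close>, so row \<open>u\<close> starts at
  \<open>n * u\<close>. The number \<open>m\<close> of rows is separate from \<open>n\<close> so
  that the induction can append rows of fixed length.\<close>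

lemma nth_concat_map_upt:
  assumes "u < m" "v < n"
  shows "concat (map (\<lambda>u. map (f u) [0..<n]) [0..<m]) ! (n * u + v) = f u v"
  using assms(1)
proof (induction m)
  case (Suc m)
  have len: "length (concat (map (\<lambda>u. map (f u) [0..<n]) [0..<m])) = n * m"
    by (simp add: length_concat o_def sum_list_triv)
  show ?case
  proof (cases "u = m")
    case True
    then show ?thesis using assms(2) len by (simp add: nth_append)
  next
    case False
    then have "u < m" using Suc.prems by simp
    have "n * u + v < n * Suc u" using assms(2) by simp
    also have "\<dots> \<le> n * m" using \<open>u < m\<close> by (intro mult_le_mono2) simp
    finally show ?thesis using len Suc.IH[OF \<open>u < m\<close>] by (simp add: nth_append)
  qed
qed simp

context
  fixes G :: "nat pair_pre_digraph" and n :: nat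
  assumes verts: "pverts G = {0..<n}"
begin

lemma length_encode_digraph: "length (encode_digraph G) = Suc (n + n * n)"
  by (simp add: encode_digraph_def verts Let_def length_concat o_def sum_list_triv)

lemma encode_digraph_unary: "j < n \<Longrightarrow> encode_digraph G ! j"
  by (simp add: encode_digraph_def verts Let_def nth_append)

lemma encode_digraph_separator: "\<not> encode_digraph G ! n"
  by (simp add: encode_digraph_def verts Let_def nth_append)

lemma encode_digraph_matrix:
  assumes "u < n" "v < n"
  shows "encode_digraph G ! (Suc n + n * u + v) \<longleftrightarrow> (u, v) \<in> parcs G"
  using nth_concat_map_upt[OF assms, of "\<lambda>u v. (u, v) \<in> parcs G"]
  by (simp add: encode_digraph_def verts Let_def nth_append add.assoc)

end


theorem proposition3:
  shows "polynomial_time_solvable (induced_subdivision_problem C3)"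
proof -
  have "\<exists>t \<le> poly (monom 7 3) (length (encode_digraph G)).
      tm_state_after cycle_tm (encode_digraph G) t =
        (if has_induced_subdivision C3 G then tm_accept cycle_tm else tm_reject cycle_tm)"
    if G: "oriented_graph G" and verts: "pverts G = {0..<n}" for G n
  proof -
    let ?w = "encode_digraph G" and ?R = "parcs G"
    define I where "I = fst (input_tape ?w)"
    interpret pair_digraph G using G by (simp add: oriented_graph_def)
    have len: "length ?w = Suc (n + n * n)" by (rule length_encode_digraph[OF verts])
    have I_nth: "I (int j) = symbol_of_bit (?w ! j)" if "j < Suc (n + n * n)" for j
    proof -
      have "int j < int (length ?w)" using that by (simp only: len of_nat_less_iff)
      then show ?thesis by (simp add: I_def input_tape_def)
    qed
    have unary: "I (int j) = 2" if "j < n" for j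
      using that I_nth[of j] encode_digraph_unary[OF verts that] by simp
    have separator: "I (int n) = 1"
      using I_nth[of n] encode_digraph_separator[OF verts] by simp
    have matrix: "I (int (Suc n + n * u + v)) = (if (u, v) \<in> ?R then 2 else 1)"
      if "u < n" "v < n" for u v
    proof -
      have "n * u + v < n * Suc u" using that by simp
      also have "\<dots> \<le> n * n" using that by (intro mult_le_mono2) simp
      finally have "Suc n + n * u + v < Suc (n + n * n)" by simp
      from I_nth[OF this] show ?thesis
        using encode_digraph_matrix[OF verts that] by simp
    qed
    have input_end: "I (int (Suc n + n * n)) = 0"
      by (simp add: I_def input_tape_def len)
    have initial: "tm_initial cycle_tm ?w =
        cycle_config q_init I 0 (\<lambda>_. 0) 0 (\<lambda>_. 0) 0 (\<lambda>_. 0) 0"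
      by (simp add: tm_initial_def cycle_tm_def I_def input_tape_def blank_tape_def
          numeral_3_eq_3)
    have R: "?R \<subseteq> {..<n} \<times> {..<n}"
      using in_arcsD1 in_arcsD2 verts by fastforce
    have "has_induced_subdivision C3 G \<longleftrightarrow> (pred_set n ?R ^^ n) UNIV \<inter> {..<n} \<noteq> {}"
      using has_induced_subdivision_C3_iff[OF G] pred_set_iterate_empty_iff[OF R] by blast
    moreover obtain ts t where "t \<le> 7 * (n + 1) ^ 3"
      "(tm_step cycle_tm ^^ t) (tm_initial cycle_tm ?w) =
        (if (pred_set n ?R ^^ n) UNIV \<inter> {..<n} \<noteq> {} then q_accept else q_reject, ts)"
      using cycle_tm_decides[of n I ?R, OF unary separator matrix input_end]
      unfolding reaches_within_def initial by blast
    ultimately obtain t where "t \<le> 7 * (n + 1) ^ 3"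
      "tm_state_after cycle_tm ?w t = (if has_induced_subdivision C3 G then q_accept else q_reject)"
      by (simp add: tm_state_after_def)
    \<comment> \<open>The encoding has length \<open>n * n + n + 1\<close>, which is at least
      \<open>n + 1\<close>, so the cubic bound in \<open>n\<close> carries over to the input
      length.\<close>
    moreover have "7 * (n + 1) ^ 3 \<le> poly (monom 7 3) (length ?w)"
      by (simp add: poly_monom len power_mono del: power_Suc)
    ultimately show ?thesis
      by (intro exI[of _ t]) (simp add: cycle_tm_def)
  qed
  then show ?thesis
    unfolding polynomial_time_solvable_def induced_subdivision_problem_def
    using wf_cycle_tm
    by (intro exI[of _ cycle_tm] exI[of _ "monom 7 3"] conjI ballI)
       (simp_all split del: if_split, blast)
qed

end
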